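(* Let $A$ and $B$ be two nonempty closed subsets of a $0$-complete partial metric space $(X,p)$ such that $X=A\cup B$, and suppose $T:X\to X$ is a cyclical contraction, i.e. $T(A)\subseteq B$, $T(B)\subseteq A$, and there exists $0<\alpha<1$ such that $p(Tx,Ty)\le \alpha\, p(x,y)$ for all $x\in A$ and all $y\in B$. Then $T$ has a unique fixed point in $A\cap B$.
   Context: A partial metric space is a pair $(X,p)$ with $p:X\times X\to[0,\infty)$ such that for all $x,y,z\in X$: (P1) $p(x,y)=p(y,x)$; (P2) if $p(x,x)=p(x,y)=p(y,y)$ then $x=y$; (P3) $p(x,x)\le p(x,y)$; (P4) $p(x,z)+p(y,y)\le p(x,y)+p(y,z)$. The topology $\tau_p$ on $X$ has as base the open $p$-balls $B_p(x,\varepsilon)=\{y\in X: p(x,y)<p(x,x)+\varepsilon\}$, $x\in X$, $\varepsilon>0$; "closed" means closed with respect to $\tau_p$. A sequence $\{x_n\}$ converges to $x\in X$ (with respect to $\tau_p$) if and only if $\lim_{n\to\infty}p(x,x_n)=p(x,x)$. A sequence $\{x_n\}$ is $0$-Cauchy if $\lim_{m,n\to\infty}p(x_n,x_m)=0$. The space $(X,p)$ is $0$-complete if every $0$-Cauchy sequence in $X$ converges with respect to $\tau_p$ to a point $x\in X$ with $p(x,x)=0$. *)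

theory Defs
  imports "HOL-Analysis.Analysis"
begin

text \<open>Unlike in a metric space, the self-distance \<open>p x x\<close> need not be zero.\<close>

locale partial_metric_space =
  fixes X :: "'a set" and p :: "'a \<Rightarrow> 'a \<Rightarrow> real"
  assumes nonneg: "\<And>x y. \<lbrakk>x \<in> X; y \<in> X\<rbrakk> \<Longrightarrow> 0 \<le> p x y"
    and commute: "\<And>x y. \<lbrakk>x \<in> X; y \<in> X\<rbrakk> \<Longrightarrow> p x y = p y x"
    and eqI: "\<And>x y. \<lbrakk>x \<in> X; y \<in> X; p x x = p x y; p x y = p y y\<rbrakk> \<Longrightarrow> x = y"
    and self_le: "\<And>x y. \<lbrakk>x \<in> X; y \<in> X\<rbrakk> \<Longrightarrow> p x x \<le> p x y"
    and triangle: "\<And>x y z. \<lbrakk>x \<in> X; y \<in> X; z \<in> X\<rbrakk> \<Longrightarrow> p x z + p y y \<le> p x y + p y z"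
begin

definition pball :: "'a \<Rightarrow> real \<Rightarrow> 'a set" where
  "pball x \<epsilon> = {y \<in> X. p x y < p x x + \<epsilon>}"

definition ptopology :: "'a topology" where
  "ptopology = topology (arbitrary union_of (\<lambda>U. \<exists>x\<in>X. \<exists>\<epsilon>>0. U = pball x \<epsilon>))"

definition zero_Cauchy :: "(nat \<Rightarrow> 'a) \<Rightarrow> bool" where
  "zero_Cauchy s \<longleftrightarrow> range s \<subseteq> X \<and>
     ((\<lambda>(m, n). p (s m) (s n)) \<longlongrightarrow> 0) (sequentially \<times>\<^sub>F sequentially)"

definition zero_complete :: bool where
  "zero_complete \<longleftrightarrow>
     (\<forall>s. zero_Cauchy s \<longrightarrow> (\<exists>x\<in>X. limitin ptopology s x sequentially \<and> p x x = 0))"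

definition cyclical_contraction :: "'a set \<Rightarrow> 'a set \<Rightarrow> ('a \<Rightarrow> 'a) \<Rightarrow> bool" where
  "cyclical_contraction A B T \<longleftrightarrow> T ` A \<subseteq> B \<and> T ` B \<subseteq> A \<and>
     (\<exists>\<alpha>. 0 < \<alpha> \<and> \<alpha> < 1 \<and> (\<forall>x\<in>A. \<forall>y\<in>B. p (T x) (T y) \<le> \<alpha> * p x y))"

lemma pball_subset: "pball x \<epsilon> \<subseteq> X"
  by (auto simp: pball_def)

lemma centre_in_pball: "\<lbrakk>x \<in> X; 0 < \<epsilon>\<rbrakk> \<Longrightarrow> x \<in> pball x \<epsilon>"
  by (simp add: pball_def)

lemma pball_nested:
  assumes "x \<in> X" "y \<in> pball x \<epsilon>"
  shows "\<exists>\<delta>>0. pball y \<delta> \<subseteq> pball x \<epsilon>"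
proof (intro exI conjI)
  show "0 < p x x + \<epsilon> - p x y" using assms by (simp add: pball_def)
  show "pball y (p x x + \<epsilon> - p x y) \<subseteq> pball x \<epsilon>"
  proof
    fix z assume z: "z \<in> pball y (p x x + \<epsilon> - p x y)"
    then have "p x z + p y y \<le> p x y + p y z"
      using assms by (intro triangle) (auto simp: pball_def)
    with z show "z \<in> pball x \<epsilon>" by (simp add: pball_def)
  qed
qed

lemma pball_mono: "\<epsilon> \<le> \<delta> \<Longrightarrow> pball x \<epsilon> \<subseteq> pball x \<delta>"
  by (auto simp: pball_def)

lemma openin_ptopology_base:
  "openin ptopology = arbitrary union_of (\<lambda>U. \<exists>x\<in>X. \<exists>\<epsilon>>0. U = pball x \<epsilon>)"
proof -
  let ?P = "\<lambda>U. \<exists>x\<in>X. \<exists>\<epsilon>>0. U = pball x \<epsilon>"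
  have "(arbitrary union_of ?P) (S \<inter> U)" if PS: "?P S" and PU: "?P U" for S U
  proof -
    obtain x \<epsilon> where S: "x \<in> X" "S = pball x \<epsilon>" using PS by blast
    obtain y \<delta> where U: "y \<in> X" "U = pball y \<delta>" using PU by blast
    have "\<exists>W. ?P W \<and> z \<in> W \<and> W \<subseteq> S \<inter> U" if z: "z \<in> S \<inter> U" for z
    proof -
      have "z \<in> X" using z S pball_subset by blast
      obtain a where a: "a > 0" "pball z a \<subseteq> S" using pball_nested S z by blast
      obtain b where b: "b > 0" "pball z b \<subseteq> U" using pball_nested U z by blast
      have "pball z (min a b) \<subseteq> S \<inter> U"
        using a b pball_mono[of "min a b" a z] pball_mono[of "min a b" b z] by auto
      moreover have "min a b > 0" using a b by simp
      ultimately show ?thesis using \<open>z \<in> X\<close> centre_in_pball by blast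
    qed
    then show ?thesis
      unfolding arbitrary_union_of_alt by blast
  qed
  then show ?thesis
    unfolding ptopology_def by (intro topology_inverse') (simp add: istopology_base_eq)
qed

lemma openin_ptopology:
  "openin ptopology U \<longleftrightarrow> U \<subseteq> X \<and> (\<forall>x\<in>U. \<exists>\<epsilon>>0. pball x \<epsilon> \<subseteq> U)"
proof
  assume "openin ptopology U"
  then have *: "\<exists>W. (\<exists>y\<in>X. \<exists>\<epsilon>>0. W = pball y \<epsilon>) \<and> x \<in> W \<and> W \<subseteq> U" if "x \<in> U" for x
    using that unfolding openin_ptopology_base arbitrary_union_of_alt by blast
  show "U \<subseteq> X \<and> (\<forall>x\<in>U. \<exists>\<epsilon>>0. pball x \<epsilon> \<subseteq> U)"
  proof (intro conjI ballI subsetI)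
    fix x assume "x \<in> U"
    then obtain y \<epsilon> where y: "y \<in> X" "x \<in> pball y \<epsilon>" "pball y \<epsilon> \<subseteq> U"
      using *[of x] by blast
    then show "x \<in> X" using pball_subset by blast
    show "\<exists>\<epsilon>>0. pball x \<epsilon> \<subseteq> U" using pball_nested[OF y(1,2)] y(3) by blast
  qed
next
  assume "U \<subseteq> X \<and> (\<forall>x\<in>U. \<exists>\<epsilon>>0. pball x \<epsilon> \<subseteq> U)"
  then have "\<exists>W. (\<exists>y\<in>X. \<exists>\<epsilon>>0. W = pball y \<epsilon>) \<and> x \<in> W \<and> W \<subseteq> U" if "x \<in> U" for x
    using that centre_in_pball by blast
  then show "openin ptopology U"
    unfolding openin_ptopology_base arbitrary_union_of_alt by blast
qed

lemma topspace_ptopology [simp]: "topspace ptopology = X"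
proof (rule antisym)
  show "topspace ptopology \<subseteq> X" using openin_ptopology openin_topspace by blast
  have "openin ptopology X"
    unfolding openin_ptopology using pball_subset by (auto intro: exI[of _ 1])
  then show "X \<subseteq> topspace ptopology" by (rule openin_subset)
qed

text \<open>Convergence in the topology is the usual sequential criterion for partial metrics.\<close>

lemma limitin_ptopology:
  assumes "range s \<subseteq> X"
  shows "limitin ptopology s x sequentially \<longleftrightarrow> x \<in> X \<and> (\<lambda>n. p x (s n)) \<longlonglongrightarrow> p x x"
proof (cases "x \<in> X")
  case True
  have sX: "s n \<in> X" for n using assms by auto
  have le: "p x x \<le> p x (s n)" for n using True sX by (rule self_le)
  have open_ball: "openin ptopology (pball x \<epsilon>)" for \<epsilon>
    unfolding openin_ptopology using pball_nested[OF True] pball_subset by blast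
  have "limitin ptopology s x sequentially \<longleftrightarrow> (\<forall>\<epsilon>>0. \<forall>\<^sub>F n in sequentially. s n \<in> pball x \<epsilon>)"
  proof
    assume "limitin ptopology s x sequentially"
    then show "\<forall>\<epsilon>>0. \<forall>\<^sub>F n in sequentially. s n \<in> pball x \<epsilon>"
      using open_ball centre_in_pball[OF True] unfolding limitin_def by blast
  next
    assume R: "\<forall>\<epsilon>>0. \<forall>\<^sub>F n in sequentially. s n \<in> pball x \<epsilon>"
    have "\<forall>\<^sub>F n in sequentially. s n \<in> U" if U: "openin ptopology U" "x \<in> U" for U
    proof -
      obtain \<epsilon> where e: "\<epsilon> > 0" "pball x \<epsilon> \<subseteq> U"
        using U openin_ptopology by meson
      have "\<forall>\<^sub>F n in sequentially. s n \<in> pball x \<epsilon>" using R e(1) by blast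
      then show ?thesis by (rule eventually_mono) (use e(2) in blast)
    qed
    then show "limitin ptopology s x sequentially" using True by (simp add: limitin_def)
  qed
  also have "\<dots> \<longleftrightarrow> (\<lambda>n. p x (s n)) \<longlonglongrightarrow> p x x"
  proof -
    have "s n \<in> pball x \<epsilon> \<longleftrightarrow> dist (p x (s n)) (p x x) < \<epsilon>" for n \<epsilon>
      using le[of n] sX by (auto simp: pball_def dist_real_def)
    then show ?thesis by (simp add: tendsto_iff)
  qed
  finally show ?thesis using True by simp
next
  case False
  then show ?thesis by (simp add: limitin_def)
qed

end

end

theory Submission
  imports Defs
begin

text \<open>
  Consecutive points of an orbit of \<open>T\<close> lie in opposite sets, so the contraction condition applies
  to them and makes their distances decay geometrically. Hence the orbit is 0-Cauchy and has a limit
  \<open>x\<close> with \<open>p x x = 0\<close>. The even and the odd iterates converge to \<open>x\<close> as well, so \<open>x \<in> A \<inter> B\<close> by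
  closedness; this lets the contraction condition compare \<open>x\<close> with every point of the orbit,
  whichever set that point lies in, and gives \<open>p x (T x) = 0\<close>.
\<close>

context partial_metric_space
begin

text \<open>By (P3) and nonnegativity both self-distances are squeezed between 0 and
  \<open>p x y = 0\<close>, so all three values agree and (P2) applies.\<close>

lemma eq_if_dist_zero:
  assumes "x \<in> X" "y \<in> X" "p x y = 0"
  shows "x = y"
proof (rule eqI)
  show "p x x = p x y"
    using assms self_le[of x y] nonneg[of x x] by simp
  show "p x y = p y y"
    using assms self_le[of y x] nonneg[of y y] commute[of x y] by simp
qed (use assms in auto)

lemma triangle_le:
  assumes "x \<in> X" "y \<in> X" "z \<in> X"
  shows "p x z \<le> p x y + p y z"
  using triangle[OF assms] nonneg[of y y] assms(2) by linarith

text \<open>The bound is the tail of a geometric series with ratio \<alpha> and first term d *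
  \<alpha> ^ m. Its independence of \<open>k\<close> is what yields the 0-Cauchy property. The
  induction peels off the first step of the path, so \<open>m\<close> has to vary.\<close>

lemma geometric_dist_le:
  fixes \<alpha> d :: real
  assumes s: "\<And>n. s n \<in> X" and \<alpha>: "0 < \<alpha>" "\<alpha> < 1"
    and step: "\<And>n. p (s n) (s (Suc n)) \<le> d * \<alpha> ^ n"
  shows "p (s m) (s (m + k)) \<le> d / (1 - \<alpha>) * \<alpha> ^ m"
proof (induction k arbitrary: m)
  \<comment> \<open>This case has content: \<open>p (s m) (s m)\<close> need not vanish, but (P3)
    bounds it by the distance to the next point.\<close>
  case 0
  have "0 \<le> d" using step[of 0] nonneg[OF s s, of 0 "Suc 0"] by simp
  then have "d \<le> d / (1 - \<alpha>)" using \<alpha> by (simp add: field_simps)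
  then have "d * \<alpha> ^ m \<le> d / (1 - \<alpha>) * \<alpha> ^ m"
    using \<alpha> by (intro mult_right_mono) auto
  then show ?case using self_le[OF s s, of m "Suc m"] step[of m] by simp
next
  case (Suc k)
  have "p (s m) (s (m + Suc k)) \<le> p (s m) (s (Suc m)) + p (s (Suc m)) (s (Suc m + k))"
    using triangle_le[OF s s s, of m "m + Suc k" "Suc m"] by simp
  also have "\<dots> \<le> d * \<alpha> ^ m + d / (1 - \<alpha>) * \<alpha> ^ Suc m"
    by (intro add_mono step Suc.IH)
  \<comment> \<open>The constant C = d / (1 - \<alpha>) is the solution of d + C * \<alpha> = C, so
    the induction closes with the same constant.\<close>
  also have "\<dots> = d / (1 - \<alpha>) * \<alpha> ^ m"
    using \<alpha> by (simp add: field_simps)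
  finally show ?case .
qed

lemma geometric_zero_Cauchy:
  fixes \<alpha> d :: real
  assumes s: "\<And>n. s n \<in> X" and \<alpha>: "0 < \<alpha>" "\<alpha> < 1"
    and step: "\<And>n. p (s n) (s (Suc n)) \<le> d * \<alpha> ^ n"
  shows "zero_Cauchy s"
  unfolding zero_Cauchy_def
proof
  define C where "C = d / (1 - \<alpha>)"
  have "0 \<le> d" using step[of 0] nonneg[OF s s, of 0 "Suc 0"] by simp
  then have C: "0 \<le> C" using \<alpha> by (simp add: C_def)
  have C_pow: "0 \<le> C * \<alpha> ^ n" for n using C \<alpha> by simp
  have C_le: "p (s m) (s (m + k)) \<le> C * \<alpha> ^ m" for m k
    unfolding C_def by (rule geometric_dist_le[OF s \<alpha> step])
  \<comment> \<open>The sum dominates the term of the smaller index whichever of \<open>m\<close>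
    and \<open>n\<close> that is. Each summand depends on one index only, so the double limit
    reduces to two limits along the projections.\<close>
  have le: "p (s m) (s n) \<le> C * \<alpha> ^ m + C * \<alpha> ^ n" for m n
  proof (cases "m \<le> n")
    case True
    then show ?thesis using C_le[of m "n - m"] C_pow[of n] by simp
  next
    case False
    then show ?thesis
      using C_le[of n "m - n"] C_pow[of m] commute[OF s s, of m n] by simp
  qed
  have lim0: "(\<lambda>n. C * \<alpha> ^ n) \<longlonglongrightarrow> 0"
    using \<alpha> by (intro tendsto_mult_right_zero LIMSEQ_realpow_zero) auto
  have "((\<lambda>x. C * \<alpha> ^ fst x + C * \<alpha> ^ snd x) \<longlongrightarrow> 0 + 0) (sequentially \<times>\<^sub>F sequentially)"
    by (rule tendsto_add[OF filterlim_compose[OF lim0 filterlim_fst] filterlim_compose[OF lim0 filterlim_snd]])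
  then have lim: "((\<lambda>x. C * \<alpha> ^ fst x + C * \<alpha> ^ snd x) \<longlongrightarrow> 0) (sequentially \<times>\<^sub>F sequentially)"
    by simp
  show "((\<lambda>(m, n). p (s m) (s n)) \<longlongrightarrow> 0) (sequentially \<times>\<^sub>F sequentially)"
    by (rule tendsto_sandwich[OF _ _ tendsto_const lim])
      (auto intro!: always_eventually nonneg s le)
qed (use s in auto)

theorem cyclical_contraction_fixed_point:
  assumes complete: "zero_complete" and "A \<noteq> {}"
    and closed: "closedin ptopology A" "closedin ptopology B"
    and "cyclical_contraction A B T"
  shows "\<exists>!x. x \<in> A \<inter> B \<and> T x = x"
proof -
  have TA: "T x \<in> B" if "x \<in> A" for x
    using assms(5) that unfolding cyclical_contraction_def by blast
  have TB: "T x \<in> A" if "x \<in> B" for x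
    using assms(5) that unfolding cyclical_contraction_def by blast
  obtain \<alpha> where \<alpha>: "0 < \<alpha>" "\<alpha> < 1"
    and "\<forall>x\<in>A. \<forall>y\<in>B. p (T x) (T y) \<le> \<alpha> * p x y"
    using assms(5) unfolding cyclical_contraction_def by auto
  then have contr: "p (T x) (T y) \<le> \<alpha> * p x y" if "x \<in> A" "y \<in> B" for x y
    using that by blast
  have AX: "A \<subseteq> X" and BX: "B \<subseteq> X"
    using closed[THEN closedin_subset] by simp_all
  \<comment> \<open>The contraction condition fixes which argument lies in \<open>A\<close>;
    symmetry of \<open>p\<close> frees the order, as needed along an orbit that alternates between
    the sets.\<close>
  have contr': "p (T y) (T x) \<le> \<alpha> * p y x" if "x \<in> A" "y \<in> B" for x y
  proof -
    have "x \<in> X" "y \<in> X" "T x \<in> X" "T y \<in> X" using that TA TB AX BX by blast+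
    then have "p y x = p x y" "p (T y) (T x) = p (T x) (T y)" by (auto intro: commute)
    then show ?thesis using contr[OF that] by simp
  qed
  obtain a where "a \<in> A" using \<open>A \<noteq> {}\<close> by blast
  define s where "s n = (T ^^ n) a" for n
  have s_Suc: "s (Suc n) = T (s n)" for n by (simp add: s_def)
  have even_odd: "s (2 * n) \<in> A \<and> s (Suc (2 * n)) \<in> B" for n
    by (induction n) (use \<open>a \<in> A\<close> in \<open>auto simp: s_def intro: TA TB\<close>)
  have alternate: "s n \<in> A \<and> s (Suc n) \<in> B \<or> s n \<in> B \<and> s (Suc n) \<in> A" for n
  proof (cases "even n")
    case True
    then show ?thesis using even_odd[of "n div 2"] by simp
  next
    case False
    then have "Suc (2 * (n div 2)) = n" by simp
    then have "s n \<in> B" using even_odd[of "n div 2"] by metis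
    then show ?thesis using TB s_Suc[of n] by simp
  qed
  have sX: "s n \<in> X" for n using alternate[of n] AX BX by blast
  have contr_s: "p (s (Suc n)) (s (Suc (Suc n))) \<le> \<alpha> * p (s n) (s (Suc n))" for n
    using alternate[of n] contr contr' unfolding s_Suc by blast
  have "p (s n) (s (Suc n)) \<le> p (s 0) (s 1) * \<alpha> ^ n" for n
  proof (induction n)
    case (Suc n)
    have "\<alpha> * p (s n) (s (Suc n)) \<le> \<alpha> * (p (s 0) (s 1) * \<alpha> ^ n)"
      using Suc.IH \<alpha> by (intro mult_left_mono) auto
    then show ?case using contr_s[of n] by (simp add: mult_ac)
  qed simp
  then have "zero_Cauchy s" by (rule geometric_zero_Cauchy[OF sX \<alpha>])
  then obtain x where x: "x \<in> X" "limitin ptopology s x sequentially" "p x x = 0"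
    using complete unfolding zero_complete_def by blast
  have sub: "limitin ptopology (s \<circ> r) x sequentially" if "strict_mono r" for r
    using limitin_subsequence[OF that x(2)] .
  have "x \<in> A"
    by (rule limitin_closedin[OF sub[of "\<lambda>n. 2 * n"] closed(1)])
      (use even_odd in \<open>auto simp: strict_mono_def\<close>)
  have "x \<in> B"
    by (rule limitin_closedin[OF sub[of "\<lambda>n. Suc (2 * n)"] closed(2)])
      (use even_odd in \<open>auto simp: strict_mono_def\<close>)
  have TxX: "T x \<in> X" using TA \<open>x \<in> A\<close> BX by blast
  \<comment> \<open>Convergence in the topology only gives the limit \<open>p x x\<close>;
    0-completeness makes this value 0.\<close>
  have lim: "(\<lambda>n. p x (s n)) \<longlonglongrightarrow> 0"
    using x limitin_ptopology[of s x] sX by auto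
  \<comment> \<open>The triangle inequality passes through \<open>s (Suc n) = T (s n)\<close>, and
    contraction bounds its second term. Both summands then tend to 0.\<close>
  have "p x (T x) \<le> p x (s (Suc n)) + \<alpha> * p x (s n)" for n
  proof -
    have "p (T (s n)) (T x) \<le> \<alpha> * p (s n) x"
      using alternate[of n] contr contr' \<open>x \<in> A\<close> \<open>x \<in> B\<close> by blast
    then show ?thesis
      using triangle_le[OF x(1) sX TxX, of "Suc n"] commute[OF sX x(1), of n] by (simp add: s_Suc)
  qed
  moreover have "(\<lambda>n. p x (s (Suc n)) + \<alpha> * p x (s n)) \<longlonglongrightarrow> 0"
    using tendsto_add[OF LIMSEQ_Suc[OF lim] tendsto_mult_right_zero[OF lim, of \<alpha>]] by simp
  ultimately have "p x (T x) \<le> 0"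
    by (intro LIMSEQ_le_const) auto
  then have "T x = x"
    using eq_if_dist_zero[OF x(1) TxX] nonneg[OF x(1) TxX] by simp
  \<comment> \<open>Uniqueness: \<open>y\<close> is used as a point of \<open>A\<close> and
    \<open>z\<close> as a point of \<open>B\<close>, so contraction between the two fixed points
    forces \<open>p y z = 0\<close>.\<close>
  moreover have "y = z" if "y \<in> A \<inter> B" "T y = y" "z \<in> A \<inter> B" "T z = z" for y z
  proof -
    have X: "y \<in> X" "z \<in> X" using that AX by auto
    have "p y z \<le> \<alpha> * p y z" using contr[of y z] that by simp
    then have "(1 - \<alpha>) * p y z \<le> 0" by (simp add: algebra_simps)
    then have "p y z \<le> 0" using \<alpha> by (simp add: mult_le_0_iff)
    then show ?thesis using eq_if_dist_zero[OF X] nonneg[OF X] by simp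
  qed
  ultimately show ?thesis using \<open>x \<in> A\<close> \<open>x \<in> B\<close> by blast
qed

end

theorem theorem4:
  fixes X A B :: "'a set" and p :: "'a \<Rightarrow> 'a \<Rightarrow> real" and T :: "'a \<Rightarrow> 'a"
  assumes "partial_metric_space X p"
    and "partial_metric_space.zero_complete X p"
    and "A \<noteq> {}" and "B \<noteq> {}"
    and "closedin (partial_metric_space.ptopology X p) A"
    and "closedin (partial_metric_space.ptopology X p) B"
    and "X = A \<union> B"
    and "T \<in> X \<rightarrow> X"
    and "partial_metric_space.cyclical_contraction p A B T"
  shows "\<exists>!x. x \<in> A \<inter> B \<and> T x = x"
  using assms(1-3,5,6,9) by (rule partial_metric_space.cyclical_contraction_fixed_point)

end
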